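(* Let $k$ be an algebraically closed field (of arbitrary characteristic), let $f \in k[X]$ be a polynomial, and let $n \ge 2$ be a fixed integer. Then the map $M_n(f): M_n(k) \to M_n(k)$, $A \mapsto f(A)$, is not surjective if and only if there exists $t \in k$ such that $f^{-1}(t) \subseteq Z(f')$ (i.e. $f$ has a critical value).
   Context: $M_n(k)$ is the set of $n \times n$ matrices over $k$. For $f = \sum_i a_i X^i \in k[X]$, the map $M_n(f)$ sends $A$ to $f(A) = \sum_i a_i A^i$. $f'$ is the (formal) derivative of $f$, $Z(f') = \{x \in k : f'(x) = 0\}$, and $f^{-1}(t) = \{x \in k : f(x) = t\}$. An element $t \in k$ is called a critical value of $f$ if $f^{-1}(t) \subseteq Z(f')$ (this includes the case where $f^{-1}(t)$ is empty). *)

theory Defs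
  imports "Jordan_Normal_Form.Matrix" "HOL-Computational_Algebra.Polynomial"
begin

text \<open>The sum is taken in the ring of \<open>n \<times> n\<close> matrices, because the type of matrices
  of arbitrary dimensions has no additive unit.\<close>

definition mat_poly :: "nat \<Rightarrow> 'a::comm_ring_1 poly \<Rightarrow> 'a mat \<Rightarrow> 'a mat" where
  "mat_poly n f A =
     finsum (ring_mat TYPE('a) n ()) (\<lambda>i. Polynomial.coeff f i \<cdot>\<^sub>m (A ^\<^sub>m i)) {..Polynomial.degree f}"

lemma finsum_ring_mat_carrier_index:
  fixes F :: "'b \<Rightarrow> 'a::comm_ring_1 mat"
  assumes "finite I" and "\<And>i. i \<in> I \<Longrightarrow> F i \<in> carrier_mat n n"
  shows "finsum (ring_mat TYPE('a) n ()) F I \<in> carrier_mat n n \<and>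
    (\<forall>r<n. \<forall>c<n. finsum (ring_mat TYPE('a) n ()) F I $$ (r, c) = (\<Sum>i\<in>I. F i $$ (r, c)))"
  using assms
proof (induction I rule: finite_induct)
  case empty
  interpret R: ring "ring_mat TYPE('a) n ()" by (rule ring_mat)
  show ?case by (simp add: ring_mat_simps)
next
  case (insert x I)
  interpret R: ring "ring_mat TYPE('a) n ()" by (rule ring_mat)
  have "finsum (ring_mat TYPE('a) n ()) F (insert x I) = F x + finsum (ring_mat TYPE('a) n ()) F I"
    using insert.hyps insert.prems by (subst R.finsum_insert) (auto simp: ring_mat_simps)
  then show ?case using insert by auto
qed

lemma mat_poly_carrier [simp]:
  assumes "A \<in> carrier_mat n n"
  shows "mat_poly n f A \<in> carrier_mat n n"
  unfolding mat_poly_def using assms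
  by (intro conjunct1[OF finsum_ring_mat_carrier_index]) auto

lemma mat_poly_index:
  assumes "A \<in> carrier_mat n n" "r < n" "c < n"
  shows "mat_poly n f A $$ (r, c) = (\<Sum>i\<le>Polynomial.degree f. Polynomial.coeff f i * (A ^\<^sub>m i) $$ (r, c))"
proof -
  have "mat_poly n f A $$ (r, c) =
      (\<Sum>i\<le>Polynomial.degree f. (Polynomial.coeff f i \<cdot>\<^sub>m (A ^\<^sub>m i)) $$ (r, c))"
    unfolding mat_poly_def using assms
    by (intro conjunct2[OF finsum_ring_mat_carrier_index, rule_format]) auto
  then show ?thesis using assms by simp
qed

text \<open>An element with empty preimage counts as a critical value.\<close>

definition critical_value :: "'a::idom poly \<Rightarrow> 'a \<Rightarrow> bool" where
  "critical_value f t \<longleftrightarrow> poly f -` {t} \<subseteq> {x. poly (pderiv f) x = 0}"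

end

theory Submission
  imports Defs "Jordan_Normal_Form.Jordan_Normal_Form"
begin

text \<open>If \<open>t\<close> is a critical value, the Jordan block of size \<open>n\<close> for \<open>t\<close> is not of the form \<open>f(A)\<close>:
  every eigenvalue \<open>x\<close> of \<open>A\<close> would be a multiple root of \<open>f - t\<close>, so \<open>(f - t)^(n - 1)\<close> would vanish
  to order at least \<open>2 (n - 1) \<ge> n\<close> at \<open>x\<close>. It would then be divisible by the characteristic polynomial
  of \<open>A\<close> and annihilate \<open>A\<close>, whereas the nilpotent Jordan block has nonzero \<open>(n - 1)\<close>-st power.
  Conversely, without critical values every \<open>t\<close> has a simple preimage, so Hensel lifting yields a
  polynomial \<open>h\<close> with \<open>f(h(X)) \<equiv> X\<close> modulo the characteristic polynomial of \<open>B\<close>, and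
  \<open>f(h(B)) = B\<close> by Cayley--Hamilton.\<close>

section \<open>Evaluating polynomials at a matrix\<close>

text \<open>Coefficients beyond the degree vanish, so any larger summation bound may be used. This
  lets polynomials of different degrees be compared over one index range.\<close>

lemma mat_poly_index_coeff_bound:
  assumes "A \<in> carrier_mat n n" "r < n" "c < n" "degree f \<le> m"
  shows "mat_poly n f A $$ (r, c) = (\<Sum>i\<le>m. coeff f i * (A ^\<^sub>m i) $$ (r, c))"
proof -
  have "(\<Sum>i\<le>degree f. coeff f i * (A ^\<^sub>m i) $$ (r, c)) = (\<Sum>i\<le>m. coeff f i * (A ^\<^sub>m i) $$ (r, c))"
    using assms(4) by (intro sum.mono_neutral_left) (auto simp: coeff_eq_0)
  then show ?thesis using assms by (simp add: mat_poly_index)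
qed

text \<open>The recursion for powers multiplies on the right, whereas the Horner form
  \<open>a + A * f(A)\<close> needs the factor on the left.\<close>

lemma pow_mat_Suc_left:
  assumes "A \<in> carrier_mat n n"
  shows "A ^\<^sub>m Suc i = A * A ^\<^sub>m i"
proof (induction i)
  case 0
  then show ?case using assms by simp
next
  case (Suc i)
  have "A ^\<^sub>m Suc (Suc i) = (A * A ^\<^sub>m i) * A" using Suc by simp
  also have "\<dots> = A * (A ^\<^sub>m i * A)"
    using assms by (intro assoc_mult_mat) auto
  finally show ?case by simp
qed

lemma mult_mat_index:
  assumes "A \<in> carrier_mat n n" "B \<in> carrier_mat n n" "r < n" "c < n"
  shows "(A * B) $$ (r, c) = (\<Sum>s<n. A $$ (r, s) * B $$ (s, c))"
  using assms by (auto simp: scalar_prod_def atLeast0LessThan intro!: sum.cong)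

section \<open>Evaluation at a fixed matrix as a ring homomorphism\<close>

lemma mat_poly_0: "A \<in> carrier_mat n n \<Longrightarrow> mat_poly n 0 A = 0\<^sub>m n n"
  by (intro eq_matI) (auto simp: mat_poly_index carrier_matD[OF mat_poly_carrier])

text \<open>Horner's rule: it turns the entrywise sum into a recursion, so that products,
  compositions and the action on eigenvectors can be treated by induction on
  \<open>f\<close>.\<close>

lemma mat_poly_pCons:
  assumes A: "A \<in> carrier_mat n n"
  shows "mat_poly n (pCons a f) A = a \<cdot>\<^sub>m 1\<^sub>m n + A * mat_poly n f A"
proof (rule eq_matI)
  note [simp] = carrier_matD[OF mat_poly_carrier[OF A]] carrier_matD[OF A]
  fix r c assume "r < dim_row (a \<cdot>\<^sub>m 1\<^sub>m n + A * mat_poly n f A)" "c < dim_col (a \<cdot>\<^sub>m 1\<^sub>m n + A * mat_poly n f A)"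
  then have rc: "r < n" "c < n" by auto
  have "mat_poly n (pCons a f) A $$ (r, c)
      = (\<Sum>i\<le>Suc (degree f). coeff (pCons a f) i * (A ^\<^sub>m i) $$ (r, c))"
    using A rc by (intro mat_poly_index_coeff_bound) (auto simp: degree_pCons_le)
  also have "\<dots> = a * (1\<^sub>m n) $$ (r, c) + (\<Sum>i\<le>degree f. coeff f i * (A ^\<^sub>m Suc i) $$ (r, c))"
    by (subst sum.atMost_Suc_shift) simp
  also have "(\<Sum>i\<le>degree f. coeff f i * (A ^\<^sub>m Suc i) $$ (r, c))
      = (\<Sum>i\<le>degree f. \<Sum>s<n. A $$ (r, s) * (coeff f i * (A ^\<^sub>m i) $$ (s, c)))"
    unfolding pow_mat_Suc_left[OF A] using A rc
    by (intro sum.cong) (auto simp: mult_mat_index[where n = n] sum_distrib_left ac_simps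
        simp del: index_mult_mat)
  also have "\<dots> = (A * mat_poly n f A) $$ (r, c)"
    using A rc by (subst sum.swap)
      (auto simp: mult_mat_index[where n = n] mat_poly_index sum_distrib_left simp del: index_mult_mat)
  finally show "mat_poly n (pCons a f) A $$ (r, c) = (a \<cdot>\<^sub>m 1\<^sub>m n + A * mat_poly n f A) $$ (r, c)"
    using A rc by simp
qed (auto simp: carrier_matD[OF mat_poly_carrier[OF A]] carrier_matD[OF A])

lemma mat_poly_pCons_0:
  assumes A: "A \<in> carrier_mat n n"
  shows "mat_poly n (pCons 0 f) A = A * mat_poly n f A"
  unfolding mat_poly_pCons[OF A]
  by (intro eq_matI) (use A in \<open>auto simp: carrier_matD[OF mat_poly_carrier[OF A]]\<close>)

lemma mat_poly_const: "A \<in> carrier_mat n n \<Longrightarrow> mat_poly n [:a:] A = a \<cdot>\<^sub>m 1\<^sub>m n"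
  by (simp add: mat_poly_pCons mat_poly_0)

lemma mat_poly_1: "A \<in> carrier_mat n n \<Longrightarrow> mat_poly n 1 A = 1\<^sub>m n"
  unfolding one_pCons by (simp add: mat_poly_const) (intro eq_matI; auto)

lemma mat_poly_X: "A \<in> carrier_mat n n \<Longrightarrow> mat_poly n [:0, 1:] A = A"
  by (simp add: mat_poly_pCons_0 mat_poly_1 flip: one_pCons)

lemma mat_poly_index_add:
  assumes "A \<in> carrier_mat n n" "r < n" "c < n"
  shows "mat_poly n (f + g) A $$ (r, c) = mat_poly n f A $$ (r, c) + mat_poly n g A $$ (r, c)"
  using assms
  by (simp add: mat_poly_index_coeff_bound[where m = "max (degree f) (degree g)"]
      degree_add_le sum.distrib distrib_right)

lemma mat_poly_index_smult:
  assumes "A \<in> carrier_mat n n" "r < n" "c < n"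
  shows "mat_poly n (smult a f) A $$ (r, c) = a * mat_poly n f A $$ (r, c)"
  using assms
  by (simp add: mat_poly_index_coeff_bound[where m = "degree f"] degree_smult_le
      sum_distrib_left mult.assoc)

lemma mat_poly_add:
  assumes A: "A \<in> carrier_mat n n"
  shows "mat_poly n (f + g) A = mat_poly n f A + mat_poly n g A"
  using A by (intro eq_matI) (auto simp: mat_poly_index_add carrier_matD[OF mat_poly_carrier[OF A]])

lemma mat_poly_smult:
  assumes A: "A \<in> carrier_mat n n"
  shows "mat_poly n (smult a f) A = a \<cdot>\<^sub>m mat_poly n f A"
  using A by (intro eq_matI) (auto simp: mat_poly_index_smult carrier_matD[OF mat_poly_carrier[OF A]])

lemma mat_poly_index_sum:
  assumes "A \<in> carrier_mat n n" "r < n" "c < n"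
  shows "mat_poly n (\<Sum>i\<in>I. F i) A $$ (r, c) = (\<Sum>i\<in>I. mat_poly n (F i) A $$ (r, c))"
  using assms by (induction I rule: infinite_finite_induct) (auto simp: mat_poly_0 mat_poly_index_add)

lemma mat_poly_mult:
  assumes A: "A \<in> carrier_mat n n"
  shows "mat_poly n (f * g) A = mat_poly n f A * mat_poly n g A"
proof (induction f)
  case 0
  then show ?case using A by (simp add: mat_poly_0 left_mult_zero_mat[where nr = n and n = n and nc = n])
next
  case (pCons a f)
  have F: "mat_poly n f A \<in> carrier_mat n n" and G: "mat_poly n g A \<in> carrier_mat n n"
    using A by auto
  have "mat_poly n (pCons a f * g) A = a \<cdot>\<^sub>m mat_poly n g A + A * (mat_poly n f A * mat_poly n g A)"
    using A G F by (simp add: mat_poly_add mat_poly_smult mat_poly_pCons_0 pCons.IH)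
  also have "\<dots> = (a \<cdot>\<^sub>m 1\<^sub>m n) * mat_poly n g A + (A * mat_poly n f A) * mat_poly n g A"
    using A G F by (simp add: mult_smult_assoc_mat[of _ n n _ n] left_mult_one_mat[OF G] assoc_mult_mat[of _ n n _ n _ n])
  also have "\<dots> = mat_poly n (pCons a f) A * mat_poly n g A"
    using A G F by (simp add: mat_poly_pCons add_mult_distrib_mat[of _ n n _ _ n])
  finally show ?case .
qed

lemma mat_poly_pcompose:
  assumes A: "A \<in> carrier_mat n n"
  shows "mat_poly n (pcompose f g) A = mat_poly n f (mat_poly n g A)"
  by (induction f)
    (use A in \<open>simp_all add: mat_poly_0 pcompose_pCons mat_poly_pCons mat_poly_add mat_poly_mult mat_poly_const
      mat_poly_carrier\<close>)

lemma mat_poly_power: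
  assumes A: "A \<in> carrier_mat n n"
  shows "mat_poly n (f ^ k) A = mat_poly n f A ^\<^sub>m k"
proof (induction k)
  case 0
  then show ?case using A by (simp add: mat_poly_1 carrier_matD[OF mat_poly_carrier[OF A]])
next
  case (Suc k)
  have "mat_poly n (f ^ Suc k) A = mat_poly n (f ^ k * f) A" by (simp add: mult.commute)
  with Suc show ?case using A by (simp add: mat_poly_mult)
qed

section \<open>Eigenvectors and the Cayley-Hamilton theorem\<close>

lemma scalar_mat_mult_vec:
  fixes v :: "'a::comm_ring_1 vec"
  assumes "v \<in> carrier_vec n"
  shows "(a \<cdot>\<^sub>m 1\<^sub>m n) *\<^sub>v v = a \<cdot>\<^sub>v v"
  by (intro eq_vecI) (use assms in \<open>auto simp: smult_scalar_prod_distrib[of _ n] scalar_prod_left_unit\<close>)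

lemma mult_mat_smult_vec:
  fixes A :: "'a::comm_ring_1 mat"
  assumes "A \<in> carrier_mat m n" "v \<in> carrier_vec n"
  shows "A *\<^sub>v (k \<cdot>\<^sub>v v) = k \<cdot>\<^sub>v (A *\<^sub>v v)"
  by (intro eq_vecI) (use assms in \<open>auto simp: scalar_prod_smult_distrib[of _ n]\<close>)

lemma mat_poly_mult_eigenvector:
  assumes A: "A \<in> carrier_mat n n" and v: "v \<in> carrier_vec n" and ev: "A *\<^sub>v v = x \<cdot>\<^sub>v v"
  shows "mat_poly n f A *\<^sub>v v = poly f x \<cdot>\<^sub>v v"
proof (induction f)
  case 0
  then show ?case using A v by (simp add: mat_poly_0) (intro eq_vecI; auto)
next
  case (pCons a f)
  have F: "mat_poly n f A \<in> carrier_mat n n" using A by auto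
  have "mat_poly n (pCons a f) A *\<^sub>v v = a \<cdot>\<^sub>v v + A *\<^sub>v (mat_poly n f A *\<^sub>v v)"
    using A F v by (simp add: mat_poly_pCons add_mult_distrib_mat_vec[of _ n n]
        assoc_mult_mat_vec[of _ n n _ n] scalar_mat_mult_vec)
  also have "A *\<^sub>v (mat_poly n f A *\<^sub>v v) = poly f x \<cdot>\<^sub>v (x \<cdot>\<^sub>v v)"
    unfolding pCons.IH mult_mat_smult_vec[OF A v] ev ..
  finally show ?case using v by (simp add: smult_smult_assoc add_smult_distrib_vec ac_simps)
qed

lemma eigenvalue_mat_poly:
  fixes A :: "'a :: comm_ring_1 mat"
  assumes A: "A \<in> carrier_mat n n" and "eigenvalue A x"
  shows "eigenvalue (mat_poly n f A) (poly f x)"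
  using assms mat_poly_mult_eigenvector[OF A] carrier_matD[OF mat_poly_carrier[OF A]]
  unfolding eigenvalue_def eigenvector_def by auto

text \<open>View the column vectors as a module over the polynomial ring, with the indeterminate acting
  as \<open>A\<close>. The columns of \<open>char_poly_matrix A\<close>, read as linear combinations of the standard basis,
  vanish in this module; hence so do the columns of its product with the adjugate.\<close>

lemma cayley_hamilton:
  fixes A :: "'a :: comm_ring_1 mat"
  assumes A: "A \<in> carrier_mat n n"
  shows "mat_poly n (char_poly A) A = 0\<^sub>m n n"
proof (rule eq_matI)
  note [simp] = carrier_matD[OF A]
  define Q where "Q = char_poly_matrix A"
  define R where "R = adj_mat Q"
  have Q: "Q \<in> carrier_mat n n" unfolding Q_def using A by simp
  have R: "R \<in> carrier_mat n n" and QR: "Q * R = char_poly A \<cdot>\<^sub>m 1\<^sub>m n"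
    unfolding R_def using adj_mat[OF Q] by (auto simp: Q_def char_poly_def)
  let ?E = "\<lambda>q r c. mat_poly n q A $$ (r, c)"
  have entry: "?E [:b, 1:] r c = (if r = c then b else 0) + A $$ (r, c)" if "r < n" "c < n" for b r c
  proof -
    have "?E ([:b:] + [:0, 1:]) r c = (if r = c then b else 0) + A $$ (r, c)"
      unfolding mat_poly_index_add[OF A that] mat_poly_X[OF A] mat_poly_const[OF A] using that by simp
    then show ?thesis by simp
  qed
  \<comment> \<open>With \<open>e_i\<close> the standard basis, this is the \<open>s\<close>-th
    coordinate of \<open>A e_k - (\<Sum>i. A_ik e_i) = 0\<close>; the first term comes from the
    indeterminate on the diagonal of \<open>Q\<close>.\<close>
  have relation: "(\<Sum>i<n. ?E (Q $$ (i, k)) s i) = 0" if "s < n" "k < n" for s k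
  proof -
    have "?E (Q $$ (i, k)) s i
        = (if i = k then A $$ (s, i) else 0) - (if i = s then A $$ (i, k) else 0)" if i: "i < n" for i
    proof (cases "i = k")
      case True
      then have "Q $$ (i, k) = [:- A $$ (i, k), 1:]"
        using i \<open>k < n\<close> by (simp add: Q_def char_poly_matrix_def)
      then show ?thesis using True entry[OF \<open>s < n\<close> i] by simp
    next
      case False
      then have "Q $$ (i, k) = [:- A $$ (i, k):]"
        using i \<open>k < n\<close> by (simp add: Q_def char_poly_matrix_def)
      then show ?thesis using False \<open>s < n\<close> i by (auto simp: mat_poly_const[OF A])
    qed
    then show ?thesis using that by (simp add: sum_subtractf)
  qed
  fix r j assume "r < dim_row (0\<^sub>m n n :: 'a mat)" "j < dim_col (0\<^sub>m n n :: 'a mat)"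
  then have rj: "r < n" "j < n" by auto
  \<comment> \<open>The Kronecker delta is inserted so that the summands become the entries of
    \<open>Q * R\<close>, evaluated at \<open>A\<close> and applied to \<open>e_i\<close>.\<close>
  have "?E (char_poly A) r j = (\<Sum>i<n. if i = j then ?E (char_poly A) r j else 0)"
    using rj by simp
  also have "\<dots> = (\<Sum>i<n. ?E ((Q * R) $$ (i, j)) r i)"
    unfolding QR using A rj by (intro sum.cong) (auto simp: mat_poly_0)
  also have "\<dots> = (\<Sum>i<n. \<Sum>k<n. \<Sum>s<n. ?E (R $$ (k, j)) r s * ?E (Q $$ (i, k)) s i)"
  proof (intro sum.cong refl)
    fix i assume "i \<in> {..<n}"
    then have i: "i < n" by simp
    \<comment> \<open>The entries are polynomials and commute. Putting \<open>Q\<close> on the right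
      makes it act on \<open>e_i\<close> first, so that after reordering the sums
      \<open>relation\<close> applies to the inner one.\<close>
    have "(Q * R) $$ (i, j) = (\<Sum>k<n. R $$ (k, j) * Q $$ (i, k))"
      using mult_mat_index[OF Q R i rj(2)] by (simp add: mult.commute)
    then show "?E ((Q * R) $$ (i, j)) r i = (\<Sum>k<n. \<Sum>s<n. ?E (R $$ (k, j)) r s * ?E (Q $$ (i, k)) s i)"
      using A rj i by (simp add: mat_poly_index_sum mat_poly_mult mult_mat_index[where n = n]
          del: index_mult_mat)
  qed
  also have "\<dots> = (\<Sum>k<n. \<Sum>i<n. \<Sum>s<n. ?E (R $$ (k, j)) r s * ?E (Q $$ (i, k)) s i)"
    by (rule sum.swap)
  also have "\<dots> = (\<Sum>k<n. \<Sum>s<n. \<Sum>i<n. ?E (R $$ (k, j)) r s * ?E (Q $$ (i, k)) s i)"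
    by (intro sum.cong refl sum.swap)
  also have "\<dots> = (\<Sum>k<n. \<Sum>s<n. ?E (R $$ (k, j)) r s * (\<Sum>i<n. ?E (Q $$ (i, k)) s i))"
    by (simp add: sum_distrib_left)
  also have "\<dots> = 0" using relation by simp
  finally show "?E (char_poly A) r j = 0\<^sub>m n n $$ (r, j)" using rj by simp
qed (auto simp: carrier_matD[OF mat_poly_carrier[OF A]])

lemma mat_poly_eq_0_if_char_poly_dvd:
  fixes A :: "'a :: comm_ring_1 mat"
  assumes A: "A \<in> carrier_mat n n" and "char_poly A dvd f"
  shows "mat_poly n f A = 0\<^sub>m n n"
proof -
  obtain g where "f = char_poly A * g" using assms(2) by (elim dvdE)
  then show ?thesis using A
    by (simp add: mat_poly_mult cayley_hamilton left_mult_zero_mat[of _ n n])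
qed

section \<open>Polynomials over a field\<close>

text \<open>One factor is split off at a time: dividing \<open>q\<close> by
  \<open>[:- a, 1:]\<close> lowers its order at \<open>a\<close> by one and leaves the order at
  every other point unchanged, just as removing \<open>a\<close> does to the counts. A zero quotient
  is treated separately, because the additivity of \<open>order\<close> requires a nonzero
  product.\<close>

lemma root_product_dvd:
  fixes q :: "'a::field poly"
  assumes "\<And>x. [:- x, 1:] ^ count M x dvd q"
  shows "(\<Prod>x\<in>#M. [:- x, 1:]) dvd q"
  using assms
proof (induction M arbitrary: q)
  case (add a M)
  have "[:- a, 1:] ^ Suc (count M a) dvd q" using add.prems[of a] by simp
  then have "[:- a, 1:] dvd q" by (rule dvd_trans[rotated]) (rule dvd_power, simp)
  then obtain r where q: "q = [:- a, 1:] * r" by (elim dvdE)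
  have "[:- x, 1:] ^ count M x dvd r" for x
  proof (cases "r = 0")
    case False
    then have "q \<noteq> 0" unfolding q by (intro no_zero_divisors) auto
    then have "count (add_mset a M) x \<le> order x q"
      using add.prems[of x] order_divides by blast
    also have "order x q = order x [:- a, 1:] + order x r"
      using \<open>q \<noteq> 0\<close> unfolding q by (rule order_mult)
    also have "order x [:- a, 1:] = (if x = a then 1 else 0)"
      using order_power_n_n[of a 1] by (auto simp: order_0I)
    finally have "count M x \<le> order x r" by (auto split: if_splits)
    then show ?thesis by (simp add: order_divides)
  qed simp
  then have "(\<Prod>x\<in>#M. [:- x, 1:]) dvd r" by (rule add.IH)
  then show ?case unfolding q by (simp only: image_mset_add_mset prod_mset.add_mset mult_dvd_mono dvd_refl)
qed simp

text \<open>For \<open>g = (X - x) q\<close> the product rule gives \<open>g'(x) = q(x)\<close>, so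
  \<open>q\<close> has the root \<open>x\<close> as well.\<close>

lemma double_root_dvd:
  fixes g :: "'a::field poly"
  assumes "poly g x = 0" "poly (pderiv g) x = 0"
  shows "[:- x, 1:]\<^sup>2 dvd g"
proof -
  obtain q where q: "g = [:- x, 1:] * q"
    using assms(1) by (auto simp: poly_eq_0_iff_dvd elim: dvdE)
  have "poly q x = 0" using assms(2) unfolding q pderiv_mult by (simp add: pderiv_pCons)
  then have "[:- x, 1:] dvd q" by (simp add: poly_eq_0_iff_dvd)
  then show ?thesis unfolding q power2_eq_square by (rule mult_dvd_mono[OF dvd_refl])
qed

text \<open>Taylor expansion to first order in \<open>u\<close>. The remainder is built along
  Horner's scheme without dividing by factorials, so the argument works in every
  characteristic.\<close>

lemma pcompose_add_taylor:
  fixes f :: "'a::idom poly"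
  shows "u\<^sup>2 dvd pcompose f (h + u) - pcompose f h - u * pcompose (pderiv f) h"
proof (induction f)
  case (pCons a f)
  then obtain r where "pcompose f (h + u) - pcompose f h - u * pcompose (pderiv f) h = u\<^sup>2 * r"
    by (elim dvdE)
  then have r: "pcompose f (h + u) = pcompose f h + u * pcompose (pderiv f) h + u\<^sup>2 * r"
    by (simp add: algebra_simps)
  have "pcompose (pCons a f) (h + u) - pcompose (pCons a f) h - u * pcompose (pderiv (pCons a f)) h
      = u\<^sup>2 * (pcompose (pderiv f) h + (h + u) * r)"
    by (simp add: pcompose_pCons pcompose_add pderiv_pCons r power2_eq_square algebra_simps)
  then show ?case by simp
qed simp

text \<open>Interpolation and Hensel lifting in one induction: the next root \<open>a\<close> is handled by adding
  a scalar multiple of the product \<open>p\<close> treated so far, which leaves the values at its roots unchanged.\<close>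

lemma exists_right_inverse_mod_roots:
  fixes f :: "'a::field poly"
  assumes noncrit: "\<And>t. \<exists>x. poly f x = t \<and> poly (pderiv f) x \<noteq> 0"
  shows "\<exists>h. (\<Prod>x\<in>#M. [:- x, 1:]) dvd pcompose f h - [:0, 1:] \<and>
             (\<forall>x\<in>#M. poly (pderiv f) (poly h x) \<noteq> 0)"
proof (induction M)
  case empty
  then show ?case by simp
next
  case (add a M)
  define p where "p = (\<Prod>x\<in>#M. [:- x, 1:])"
  have root_iff: "poly p x = 0 \<longleftrightarrow> x \<in># M" for x
    unfolding p_def by (induction M) auto
  from add obtain h where h: "p dvd pcompose f h - [:0, 1:]"
    and deriv: "\<And>x. x \<in># M \<Longrightarrow> poly (pderiv f) (poly h x) \<noteq> 0"
    unfolding p_def by auto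
  obtain r where "pcompose f h - [:0, 1:] = p * r" using h by (elim dvdE)
  then have r: "pcompose f h = [:0, 1:] + p * r" by (simp add: algebra_simps)
  \<comment> \<open>The error stays divisible by \<open>p\<close> for every \<open>c\<close>. To
    gain the factor \<open>X - a\<close>, it suffices to choose \<open>c\<close> so that the
    cofactor vanishes at \<open>a\<close>.\<close>
  have step: "\<exists>s. pcompose f (h + smult c p) - [:0, 1:]
      = p * (r + smult c (pcompose (pderiv f) h) + p * s)" for c
  proof -
    obtain s where "pcompose f (h + smult c p) - pcompose f h
        - smult c p * pcompose (pderiv f) h = (smult c p)\<^sup>2 * s"
      using pcompose_add_taylor[of "smult c p" f h] by (elim dvdE)
    then have "pcompose f (h + smult c p) - [:0, 1:]
        = p * (r + smult c (pcompose (pderiv f) h) + p * smult (c\<^sup>2) s)"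
      by (simp add: r power2_eq_square algebra_simps)
    then show ?thesis ..
  qed
  obtain c where c: "p * [:- a, 1:] dvd pcompose f (h + smult c p) - [:0, 1:]"
    and deriv_a: "poly (pderiv f) (poly (h + smult c p) a) \<noteq> 0"
  proof (cases "a \<in># M")
    case True
    \<comment> \<open>Newton's correction for a repeated root: since \<open>p(a) = 0\<close>, the
      cofactor at \<open>a\<close> is \<open>r(a) + c f'(h(a))\<close>. The invariant on the
      derivative makes the division legitimate.\<close>
    define c where "c = - poly r a / poly (pderiv f) (poly h a)"
    obtain s where s: "pcompose f (h + smult c p) - [:0, 1:]
        = p * (r + smult c (pcompose (pderiv f) h) + p * s)"
      using step by blast
    have "poly (r + smult c (pcompose (pderiv f) h) + p * s) a = 0"
      using True deriv[OF True] root_iff[of a] by (simp add: c_def poly_pcompose)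
    then have "[:- a, 1:] dvd r + smult c (pcompose (pderiv f) h) + p * s"
      by (simp only: poly_eq_0_iff_dvd)
    then have "p * [:- a, 1:] dvd pcompose f (h + smult c p) - [:0, 1:]"
      unfolding s by (rule mult_dvd_mono[OF dvd_refl])
    moreover have "poly (pderiv f) (poly (h + smult c p) a) \<noteq> 0"
      using True deriv[OF True] root_iff[of a] by simp
    ultimately show ?thesis by (rule that)
  next
    case False
    then have pa: "poly p a \<noteq> 0" by (simp add: root_iff)
    obtain x where x: "poly f x = a" "poly (pderiv f) x \<noteq> 0" using noncrit by blast
    \<comment> \<open>Interpolation at a new root: this \<open>c\<close> moves the value at
      \<open>a\<close> to the simple preimage \<open>x\<close> of \<open>a\<close>. The whole error
      then vanishes at \<open>a\<close>, and cancelling \<open>p(a)\<close> shows that the cofactor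
      does too.\<close>
    define c where "c = (x - poly h a) / poly p a"
    obtain s where s: "pcompose f (h + smult c p) - [:0, 1:]
        = p * (r + smult c (pcompose (pderiv f) h) + p * s)" (is "_ = p * ?s")
      using step by blast
    have value_a: "poly (h + smult c p) a = x" using pa by (simp add: c_def)
    have "poly p a * poly ?s a = poly (pcompose f (h + smult c p) - [:0, 1:]) a"
      unfolding s by (simp only: poly_mult)
    also have "\<dots> = poly f (poly (h + smult c p) a) - a"
      by (simp only: poly_diff poly_pcompose) simp
    also have "\<dots> = 0" unfolding value_a using x by simp
    finally have "poly ?s a = 0" using pa by simp
    then have "[:- a, 1:] dvd ?s" by (simp only: poly_eq_0_iff_dvd)
    then have "p * [:- a, 1:] dvd pcompose f (h + smult c p) - [:0, 1:]"
      unfolding s by (rule mult_dvd_mono[OF dvd_refl])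
    moreover have "poly (pderiv f) (poly (h + smult c p) a) \<noteq> 0"
      unfolding value_a by (rule x)
    ultimately show ?thesis by (rule that)
  qed
  show ?case
  proof (intro exI conjI ballI)
    show "(\<Prod>x\<in>#add_mset a M. [:- x, 1:]) dvd pcompose f (h + smult c p) - [:0, 1:]"
      using c by (simp add: p_def mult.commute)
    fix x assume "x \<in># add_mset a M"
    then consider "x = a" | "x \<in># M" by auto
    then show "poly (pderiv f) (poly (h + smult c p) x) \<noteq> 0"
    proof cases
      case 2
      then show ?thesis using deriv[OF 2] root_iff[of x] by simp
    qed (use deriv_a in simp)
  qed
qed

lemma char_poly_splits:
  fixes A :: "'a::alg_closed_field mat"
  assumes "A \<in> carrier_mat n n"
  obtains M where "size M = n" "char_poly A = (\<Prod>x\<in>#M. [:- x, 1:])"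
proof -
  have deg: "degree (char_poly A) = n" and lead: "lead_coeff (char_poly A) = 1"
    using degree_monic_char_poly[OF assms] by auto
  then have "char_poly A \<noteq> 0" by auto
  then obtain M where "size M = degree (char_poly A)"
      and "char_poly A = smult (lead_coeff (char_poly A)) (\<Prod>x\<in>#M. [:- x, 1:])"
    using alg_closed_imp_factorization by blast
  then show ?thesis using deg lead by (intro that[of M]) (simp_all only: smult_1_left)
qed

section \<open>Surjectivity and critical values\<close>

lemma exists_preimage_if_no_critical_value:
  fixes f :: "'a::alg_closed_field poly"
  assumes B: "B \<in> carrier_mat n n" and "\<And>t. \<not> critical_value f t"
  shows "\<exists>A\<in>carrier_mat n n. mat_poly n f A = B"
proof -
  obtain M where M: "char_poly B = (\<Prod>x\<in>#M. [:- x, 1:])" using B by (rule char_poly_splits)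
  \<comment> \<open>The failed inclusion yields both the existence of a preimage and its
    simplicity.\<close>
  have "\<exists>x. poly f x = t \<and> poly (pderiv f) x \<noteq> 0" for t
    using assms(2)[of t] by (auto simp: critical_value_def)
  from exists_right_inverse_mod_roots[of f M, OF this]
  obtain h where "char_poly B dvd pcompose f h - [:0, 1:]" unfolding M by blast
  then obtain g where "pcompose f h - [:0, 1:] = char_poly B * g" by (elim dvdE)
  then have "pcompose f h = [:0, 1:] + char_poly B * g" by (simp add: algebra_simps)
  \<comment> \<open>The preimage is \<open>h(B)\<close>: composition turns \<open>f(h(B))\<close>
    into the value at \<open>B\<close> of \<open>X\<close> plus a multiple of the characteristic
    polynomial.\<close>
  then have "mat_poly n f (mat_poly n h B) = B"
    using B mat_poly_eq_0_if_char_poly_dvd[OF B, of "char_poly B * g"]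
    by (simp flip: mat_poly_pcompose add: mat_poly_add mat_poly_X)
  then show ?thesis using mat_poly_carrier[OF B] by blast
qed

lemma mat_poly_neq_jordan_block:
  fixes f :: "'a::alg_closed_field poly"
  assumes n: "n \<ge> 2" and A: "A \<in> carrier_mat n n" and crit: "critical_value f t"
  shows "mat_poly n f A \<noteq> jordan_block n t"
proof
  assume fA: "mat_poly n f A = jordan_block n t"
  define g where "g = f - [:t:]"
  obtain M where M: "size M = n" "char_poly A = (\<Prod>x\<in>#M. [:- x, 1:])" using A by (rule char_poly_splits)
  have "[:- x, 1:] ^ count M x dvd g ^ (n - 1)" for x
  proof (cases "x \<in># M")
    case True
    have "poly (char_poly A) x = 0"
      unfolding M using True by (induction M) auto
    then have "eigenvalue A x" using eigenvalue_root_char_poly[OF A] by simp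
    from eigenvalue_mat_poly[OF A this, of f]
    \<comment> \<open>\<open>f(x)\<close> is an eigenvalue of \<open>f(A)\<close>, and the Jordan
      block has \<open>t\<close> as its only eigenvalue.\<close>
    have "poly f x = t"
      unfolding fA by (simp add: eigenvalue_root_char_poly[OF jordan_block_carrier] jordan_block_char_poly poly_power)
    then have "poly g x = 0" "poly (pderiv g) x = 0"
      using crit by (auto simp: g_def critical_value_def pderiv_diff pderiv_pCons)
    then have "[:- x, 1:]\<^sup>2 dvd g" by (rule double_root_dvd)
    then have "([:- x, 1:]\<^sup>2) ^ (n - 1) dvd g ^ (n - 1)" by (rule dvd_power_same)
    \<comment> \<open>The multiplicity is at most \<open>n\<close>, and
      \<open>n \<le> 2 * (n - 1)\<close> holds because \<open>n \<ge> 2\<close>.\<close>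
    moreover have "[:- x, 1:] ^ count M x dvd ([:- x, 1:]\<^sup>2) ^ (n - 1)"
      unfolding power_mult[symmetric] using n M(1) size_filter_mset_lesseq[of "\<lambda>y. y = x" M]
      by (intro le_imp_power_dvd) (auto simp: count_conv_size_mset)
    ultimately show ?thesis by (rule dvd_trans[rotated])
  qed (simp add: not_in_iff)
  then have "char_poly A dvd g ^ (n - 1)"
    unfolding M(2) by (rule root_product_dvd)
  then have "0\<^sub>m n n = mat_poly n (g ^ (n - 1)) A"
    using mat_poly_eq_0_if_char_poly_dvd[OF A] by simp
  also have "\<dots> = mat_poly n g A ^\<^sub>m (n - 1)" by (rule mat_poly_power[OF A])
  also have "mat_poly n g A = jordan_block n 0"
  proof -
    have g: "g = f + [:- t:]" by (simp add: g_def)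
    show ?thesis unfolding g mat_poly_add[OF A] mat_poly_const[OF A] fA
      by (intro eq_matI) auto
  qed
  \<comment> \<open>The upper right corner is compared: it holds the only nonzero entry, a one, of
    the \<open>(n - 1)\<close>-st power of the nilpotent block.\<close>
  finally have "(0\<^sub>m n n :: 'a mat) $$ (0, n - 1) = (jordan_block n 0 ^\<^sub>m (n - 1)) $$ (0, n - 1)" by simp
  then show False using n by (simp add: jordan_block_zero_pow)
qed

theorem theorem1:
  fixes f :: "'k::alg_closed_field poly" and n :: nat
  assumes "n \<ge> 2"
  shows "mat_poly n f ` carrier_mat n n \<noteq> carrier_mat n n \<longleftrightarrow> (\<exists>t. critical_value f t)"
proof
  assume "\<exists>t. critical_value f t"
  then obtain t where "critical_value f t" ..
  from mat_poly_neq_jordan_block[OF assms _ this]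
  have "jordan_block n t \<notin> mat_poly n f ` carrier_mat n n" by (metis imageE)
  then show "mat_poly n f ` carrier_mat n n \<noteq> carrier_mat n n" by (metis jordan_block_carrier)
next
  assume "mat_poly n f ` carrier_mat n n \<noteq> carrier_mat n n"
  moreover have "mat_poly n f ` carrier_mat n n \<subseteq> carrier_mat n n" by auto
  ultimately obtain B where "B \<in> carrier_mat n n" "B \<notin> mat_poly n f ` carrier_mat n n" by blast
  then show "\<exists>t. critical_value f t"
    using exists_preimage_if_no_critical_value[of B n f] by blast
qed

end
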